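(* Let $X$ be a set and let $T_0,T_1:X^3\to X$ be compatible ternary distributive operations on $X$. Then $T:X^2\times X^2\times X^2\to X^2$ defined by $$T((x_0,x_1),(y_0,y_1),(z_0,z_1))=\bigl(T_0(T_0(x_0,y_0,y_1),z_0,z_1),\ T_1(T_1(x_1,y_0,y_1),z_0,z_1)\bigr)$$ is a ternary distributive operation on $X^2$.
   Context: A ternary operation $T$ on a set $X$ is distributive if $T(T(x,y,z),u,v)=T(T(x,u,v),T(y,u,v),T(z,u,v))$ for all $x,y,z,u,v\in X$. Two ternary operations $T_0,T_1$ on $X$ are compatible if for all elements of $X$ $$T_0(T_0(x_0,y_0,y_1),z_0,z_1)=T_0(T_0(x_0,z_0,z_1),T_0(y_0,z_0,z_1),T_1(y_1,z_0,z_1)),$$ $$T_1(T_1(x_1,y_0,y_1),z_0,z_1)=T_1(T_1(x_1,z_0,z_1),T_0(y_0,z_0,z_1),T_1(y_1,z_0,z_1)).$$ *)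

theory Defs
  imports Main
begin

definition ternary_operation :: "'a set \<Rightarrow> ('a \<Rightarrow> 'a \<Rightarrow> 'a \<Rightarrow> 'a) \<Rightarrow> bool" where
  "ternary_operation X T \<longleftrightarrow> (\<forall>x\<in>X. \<forall>y\<in>X. \<forall>z\<in>X. T x y z \<in> X)"

definition ternary_distributive :: "'a set \<Rightarrow> ('a \<Rightarrow> 'a \<Rightarrow> 'a \<Rightarrow> 'a) \<Rightarrow> bool" where
  "ternary_distributive X T \<longleftrightarrow>
     ternary_operation X T \<and>
     (\<forall>x\<in>X. \<forall>y\<in>X. \<forall>z\<in>X. \<forall>u\<in>X. \<forall>v\<in>X.
        T (T x y z) u v = T (T x u v) (T y u v) (T z u v))"

definition ternary_compatible ::
  "'a set \<Rightarrow> ('a \<Rightarrow> 'a \<Rightarrow> 'a \<Rightarrow> 'a) \<Rightarrow> ('a \<Rightarrow> 'a \<Rightarrow> 'a \<Rightarrow> 'a) \<Rightarrow> bool" where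
  "ternary_compatible X T0 T1 \<longleftrightarrow>
     ternary_operation X T0 \<and> ternary_operation X T1 \<and>
     (\<forall>x0\<in>X. \<forall>y0\<in>X. \<forall>y1\<in>X. \<forall>z0\<in>X. \<forall>z1\<in>X.
        T0 (T0 x0 y0 y1) z0 z1 = T0 (T0 x0 z0 z1) (T0 y0 z0 z1) (T1 y1 z0 z1)) \<and>
     (\<forall>x1\<in>X. \<forall>y0\<in>X. \<forall>y1\<in>X. \<forall>z0\<in>X. \<forall>z1\<in>X.
        T1 (T1 x1 y0 y1) z0 z1 = T1 (T1 x1 z0 z1) (T0 y0 z0 z1) (T1 y1 z0 z1))"

fun doubled_operation ::
  "('a \<Rightarrow> 'a \<Rightarrow> 'a \<Rightarrow> 'a) \<Rightarrow> ('a \<Rightarrow> 'a \<Rightarrow> 'a \<Rightarrow> 'a) \<Rightarrow>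
   'a \<times> 'a \<Rightarrow> 'a \<times> 'a \<Rightarrow> 'a \<times> 'a \<Rightarrow> 'a \<times> 'a" where
  "doubled_operation T0 T1 (x0, x1) (y0, y1) (z0, z1) =
     (T0 (T0 x0 y0 y1) z0 z1, T1 (T1 x1 y0 y1) z0 z1)"

end

theory Submission
  imports Defs
begin

text \<open>Compatibility of \<open>T0\<close> and \<open>T1\<close> says exactly that the binary operation
  \<open>x \<rhd> y = (T0 x0 y0 y1, T1 x1 y0 y1)\<close> on pairs is right self-distributive,
  and the operation in question is \<open>(x \<rhd> y) \<rhd> z\<close>. Right translations of \<open>\<rhd>\<close> are
  endomorphisms of \<open>\<rhd>\<close>, hence so is the composite of the translations by \<open>u\<close> and \<open>v\<close>,
  which therefore distributes over \<open>(x \<rhd> y) \<rhd> z\<close>.\<close>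

definition paired_operation ::
  "('a \<Rightarrow> 'a \<Rightarrow> 'a \<Rightarrow> 'a) \<Rightarrow> ('a \<Rightarrow> 'a \<Rightarrow> 'a \<Rightarrow> 'a) \<Rightarrow> 'a \<times> 'a \<Rightarrow> 'a \<times> 'a \<Rightarrow> 'a \<times> 'a" where
  "paired_operation T0 T1 x y = (T0 (fst x) (fst y) (snd y), T1 (snd x) (fst y) (snd y))"

lemma doubled_operation_eq_paired:
  "doubled_operation T0 T1 x y z = paired_operation T0 T1 (paired_operation T0 T1 x y) z"
  by (cases x; cases y; cases z) (simp add: paired_operation_def)

lemma paired_operation_closed:
  assumes "ternary_operation X T0" "ternary_operation X T1" "x \<in> X \<times> X" "y \<in> X \<times> X"
  shows "paired_operation T0 T1 x y \<in> X \<times> X"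
  using assms by (auto simp: paired_operation_def ternary_operation_def)

text \<open>The first and second coordinates of this equation are the two compatibility
  identities.\<close>

lemma paired_operation_self_distributive:
  assumes "ternary_compatible X T0 T1" "x \<in> X \<times> X" "y \<in> X \<times> X" "z \<in> X \<times> X"
  shows "paired_operation T0 T1 (paired_operation T0 T1 x y) z =
    paired_operation T0 T1 (paired_operation T0 T1 x z) (paired_operation T0 T1 y z)"
  using assms unfolding ternary_compatible_def by (auto simp: paired_operation_def)

lemma ternary_distributive_iterate:
  assumes closed: "\<And>x y. x \<in> A \<Longrightarrow> y \<in> A \<Longrightarrow> f x y \<in> A"
    and distrib: "\<And>x y z. x \<in> A \<Longrightarrow> y \<in> A \<Longrightarrow> z \<in> A \<Longrightarrow> f (f x y) z = f (f x z) (f y z)"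
  shows "ternary_distributive A (\<lambda>x y z. f (f x y) z)"
  unfolding ternary_distributive_def ternary_operation_def
proof (intro conjI ballI)
  fix x y z u v
  assume A: "x \<in> A" "y \<in> A" "z \<in> A" "u \<in> A" "v \<in> A"
  \<comment> \<open>Two uses of \<open>distrib\<close>, first for \<open>u\<close>, then for
    \<open>v\<close>; \<open>closed\<close> keeps the intermediate products in
    \<open>A\<close>.\<close>
  have translate: "f (f (f a b) u) v = f (f (f a u) v) (f (f b u) v)"
    if "a \<in> A" "b \<in> A" for a b
    using that A by (metis closed distrib)
  \<comment> \<open>The endomorphism passes through the outer product \<open>f (f x y) z\<close>,
    then through the inner \<open>f x y\<close>.\<close>
  show "f (f (f (f x y) z) u) v = f (f (f (f x u) v) (f (f y u) v)) (f (f z u) v)"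
    using A by (simp only: translate closed)
qed (simp add: closed)

theorem theorem6p13:
  fixes X :: "'a set"
    and T0 T1 :: "'a \<Rightarrow> 'a \<Rightarrow> 'a \<Rightarrow> 'a"
  assumes "ternary_distributive X T0"
    and "ternary_distributive X T1"
    and "ternary_compatible X T0 T1"
  shows "ternary_distributive (X \<times> X) (doubled_operation T0 T1)"
proof -
  have "ternary_operation X T0" "ternary_operation X T1"
    using assms(3) by (simp_all add: ternary_compatible_def)
  then have "ternary_distributive (X \<times> X)
      (\<lambda>x y z. paired_operation T0 T1 (paired_operation T0 T1 x y) z)"
    by (intro ternary_distributive_iterate paired_operation_closed
        paired_operation_self_distributive[OF assms(3)])
  \<comment> \<open>Folding the iterated product leaves an eta-expanded
    \<open>doubled_operation T0 T1\<close>.\<close>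
  then show ?thesis
    by (simp flip: doubled_operation_eq_paired)
qed

end
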